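(* Let $\gamma,\lambda\in\mathbb{N}_0$ with $(\lambda,\gamma)\neq(0,0)$ and let $\beta$ be a positive integer. Let $H_n(\lambda,\beta,\gamma)$ denote the coefficient of $\frac{x^n}{n!}$ in $\frac{e^{\gamma x}}{(2-e^{\beta x})^{\lambda}}$. Then for every $n\in\mathbb{N}_0$, $$H_{n+1}(\lambda,\beta,\gamma)=\gamma H_n(\lambda,\beta,\gamma)+\lambda\beta H_n(\lambda+1,\beta,\gamma+\beta).$$ *)

theory Defs
  imports "HOL-Computational_Algebra.Formal_Power_Series"
begin

text \<open>
  \<open>H n l \<beta> \<gamma>\<close> is the coefficient of \<open>x^n / n!\<close> in \<open>exp (\<gamma> x) / (2 - exp (\<beta> x))^l\<close>, read as a
  formal power series. The denominator has constant term 1, so the quotient is a genuine one: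
  multiplication by the multiplicative inverse of the denominator.
\<close>
definition H :: "nat \<Rightarrow> nat \<Rightarrow> nat \<Rightarrow> nat \<Rightarrow> real" where
  "H n l \<beta> \<gamma> = fact n * fps_nth (fps_exp (of_nat \<gamma>) / (2 - fps_exp (of_nat \<beta>)) ^ l) n"

end

theory Submission
  imports Defs
begin

text \<open>
  Passing from the coefficient of \<open>x^n / n!\<close> to that of \<open>x^(n+1) / (n+1)!\<close> is differentiation,
  and with \<open>F l \<gamma> = exp (\<gamma> x) / (2 - exp (\<beta> x))^l\<close> the product rule gives
  \<open>F l \<gamma>' = \<gamma> F l \<gamma> + l \<beta> F (l+1) (\<gamma>+\<beta>)\<close>.
\<close>

text \<open>The denominator has constant term 1, so it is a unit; this turns the quotient into a
  product to which the product rule applies.\<close>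

lemma fps_exp_over_power_eq:
  fixes b c :: "'a::field_char_0"
  shows "fps_exp c / (2 - fps_exp b) ^ l = fps_exp c * inverse (2 - fps_exp b) ^ l"
  by (simp add: fps_divide_unit fps_inverse_power fps_power_zeroth)

lemma fps_deriv_exp_over_power:
  fixes b c :: "'a::field_char_0"
  shows "fps_deriv (fps_exp c / (2 - fps_exp b) ^ l) =
           fps_const c * (fps_exp c / (2 - fps_exp b) ^ l) +
           fps_const (of_nat l * b) * (fps_exp (c + b) / (2 - fps_exp b) ^ (l + 1))"
proof -
  define G where "G = inverse (2 - fps_exp b)"
  have "fps_deriv G = fps_const b * fps_exp b * G\<^sup>2"
    unfolding G_def by (subst fps_inverse_deriv) simp_all
  \<comment> \<open>The power rule leaves \<open>G ^ (l - 1)\<close>, and \<open>G\<^sup>2\<close>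
    raises it to \<open>G ^ (l + 1)\<close>; the truncated \<open>l - 1\<close> is why
    \<open>l = 0\<close> is split off.\<close>
  then have "fps_deriv (G ^ l) = fps_const (of_nat l * b) * fps_exp b * G ^ (l + 1)"
    by (cases l) (simp_all only: fps_deriv_power', simp_all add: power2_eq_square mult_ac
        fps_of_nat[symmetric] flip: fps_const_mult)
  then show ?thesis
    unfolding fps_exp_over_power_eq G_def[symmetric]
    by (simp add: fps_exp_add_mult algebra_simps)
qed

theorem theorem9:
  fixes \<gamma> l \<beta> n :: nat
  assumes "(l, \<gamma>) \<noteq> (0, 0)"
    and "\<beta> > 0"
  shows "H (n + 1) l \<beta> \<gamma> = real \<gamma> * H n l \<beta> \<gamma> + real l * real \<beta> * H n (l + 1) \<beta> (\<gamma> + \<beta>)"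
proof -
  define F where "F k c = fps_exp (real c) / (2 - fps_exp (real \<beta>)) ^ k" for k c
  have H_F: "H m k \<beta> c = fact m * fps_nth (F k c) m" for m k c
    by (simp add: H_def F_def)
  have "fps_deriv (F l \<gamma>) =
      fps_const (real \<gamma>) * F l \<gamma> + fps_const (real l * real \<beta>) * F (l + 1) (\<gamma> + \<beta>)"
    using fps_deriv_exp_over_power[of "real \<gamma>" "real \<beta>" l] by (simp add: F_def)
  then have "fps_nth (fps_deriv (F l \<gamma>)) n =
      real \<gamma> * fps_nth (F l \<gamma>) n + real l * real \<beta> * fps_nth (F (l + 1) (\<gamma> + \<beta>)) n"
    by (simp only: fps_add_nth fps_mult_left_const_nth)
  \<comment> \<open>The factor \<open>n + 1\<close> produced by differentiation turns
    \<open>fact n\<close> into \<open>fact (n + 1)\<close>.\<close>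
  moreover have "H (n + 1) l \<beta> \<gamma> = fact n * fps_nth (fps_deriv (F l \<gamma>)) n"
    by (simp add: H_F)
  ultimately show ?thesis
    by (simp add: H_F algebra_simps)
qed

end
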